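(* Let $(G,K,H,E)$ be a trifactorised group and let $T$ be a normal subgroup of $G$. The following statements are equivalent: (1) $(G/T,KT/T,HT/T,ET/T)$ is a trifactorised group. (2) $T=(T\cap K)(T\cap E)=(T\cap H)(T\cap E)$. (3) $T=\bigl((T\cap K)H\cap(T\cap K)E\bigr)(T\cap E)$.
   Context: A trifactorised group is a tuple $(G,K,H,E)$ with $G$ a group, $K\trianglelefteq G$, $H,E\le G$, $G=KE=KH=HE$ and $K\cap E=H\cap E=1$. For subsets $X,Y$ of $G$, $XY=\{xy\mid x\in X,y\in Y\}$. *)

theory Defs
  imports "HOL-Algebra.Coset"
begin

definition trifactorised_group ::
    "('a, 'b) monoid_scheme \<Rightarrow> 'a set \<Rightarrow> 'a set \<Rightarrow> 'a set \<Rightarrow> bool" where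
  "trifactorised_group G K H E \<longleftrightarrow>
     group G \<and> K \<lhd> G \<and> subgroup H G \<and> subgroup E G \<and>
     carrier G = K <#>\<^bsub>G\<^esub> E \<and> carrier G = K <#>\<^bsub>G\<^esub> H \<and> carrier G = H <#>\<^bsub>G\<^esub> E \<and>
     K \<inter> E = {\<one>\<^bsub>G\<^esub>} \<and> H \<inter> E = {\<one>\<^bsub>G\<^esub>}"

text \<open>For a normal subgroup \<open>T\<close> of \<open>G\<close> and a subgroup \<open>X\<close> of \<open>G\<close>, \<open>quotient_subgroup G X T\<close> is the
  underlying set of \<open>XT/T\<close>. Its elements are cosets of \<open>T\<close>, so it is a subset of
  the carrier of \<open>G Mod T\<close>.\<close>

definition quotient_subgroup ::
    "('a, 'b) monoid_scheme \<Rightarrow> 'a set \<Rightarrow> 'a set \<Rightarrow> 'a set set" where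
  "quotient_subgroup G X T = carrier ((G\<lparr>carrier := X <#>\<^bsub>G\<^esub> T\<rparr>) Mod T)"

end

theory Submission
  imports Defs
begin

text \<open>
  Let \<open>X\<close> stand for either of \<open>K\<close> and \<open>H\<close>. Both are complements of \<open>E\<close>: every element of \<open>G\<close> is
  uniquely a product \<open>x e\<close> with \<open>x \<in> X\<close> and \<open>e \<in> E\<close>. Everything is read off from these two
  decompositions. The equation \<open>T = (T \<inter> X)(T \<inter> E)\<close> says that the components of
  each element of \<open>T\<close> lie again in \<open>T\<close> (\<open>factorised_iff_components\<close>).

  Of the axioms for the images of \<open>K\<close>, \<open>H\<close>, \<open>E\<close> in \<open>G/T\<close>, all pass to the quotient except the two
  that ask for trivial intersections (\<open>trifactorised_image_iff\<close>). The images of \<open>x\<close> and \<open>e\<close> coincide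
  exactly when \<open>x e\<^sup>-\<^sup>1 \<in> T\<close>, so the images of \<open>X\<close> and \<open>E\<close> intersect trivially exactly when
  components of elements of \<open>T\<close> stay in \<open>T\<close> (\<open>images_meet_trivially_iff\<close>). This links the first two
  conditions.

  For the third condition, put \<open>A = (T \<inter> K)H \<inter> (T \<inter> K)E\<close>. An element of \<open>A\<close> is \<open>m e\<close> with
  \<open>m \<in> T \<inter> K\<close>, and also \<open>n h\<close> with \<open>n \<in> T \<inter> K\<close>; thus \<open>h e\<^sup>-\<^sup>1 = n\<^sup>-\<^sup>1 m \<in> T\<close>, and a decomposition of
  \<open>T\<close> along \<open>H\<close> and \<open>E\<close> forces \<open>A \<subseteq> T\<close>. Conversely, once \<open>A \<subseteq> T\<close>, the equation \<open>T = A (T \<inter> E)\<close>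
  first splits \<open>T\<close> along \<open>K\<close> and \<open>E\<close>, and the \<open>H\<close>-component of any element of \<open>T\<close> then lies
  in \<open>A\<close>, hence in \<open>T\<close>.
\<close>

section \<open>Subgroups factorised along a pair of complements\<close>

lemma mem_set_mult_iff: "z \<in> A <#>\<^bsub>G\<^esub> B \<longleftrightarrow> (\<exists>a\<in>A. \<exists>b\<in>B. z = a \<otimes>\<^bsub>G\<^esub> b)"
  by (auto simp: set_mult_def)

context group
begin

text \<open>
  The left side only provides some decomposition of an element of \<open>T\<close> with both parts in \<open>T\<close>; since
  \<open>X\<close> and \<open>E\<close> are complements, it is the decomposition in \<open>G\<close>. Once the \<open>X\<close>-component lies in \<open>T\<close>,
  the \<open>E\<close>-component does so too.
\<close>

lemma factorised_iff_components:
  assumes T: "subgroup T G" and X: "subgroup X G" and E: "subgroup E G"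
    and G_eq: "carrier G = X <#> E" and triv: "X \<inter> E = {\<one>}"
  shows "T = (T \<inter> X) <#> (T \<inter> E) \<longleftrightarrow> (\<forall>x\<in>X. \<forall>e\<in>E. x \<otimes> e \<in> T \<longrightarrow> x \<in> T)"
proof (intro iffI ballI impI)
  fix x e
  assume T_eq: "T = (T \<inter> X) <#> (T \<inter> E)" and x: "x \<in> X" and e: "e \<in> E" and "x \<otimes> e \<in> T"
  then have "x \<otimes> e \<in> (T \<inter> X) <#> (T \<inter> E)" by blast
  then obtain y f where y: "y \<in> T" "y \<in> X" and f: "f \<in> E" and eq: "x \<otimes> e = y \<otimes> f"
    unfolding mem_set_mult_iff by blast
  have carr: "x \<in> carrier G" "y \<in> carrier G" "e \<in> carrier G" "f \<in> carrier G"
    using x y e f subgroup.mem_carrier X E by metis+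
  have "inv y \<otimes> x = inv y \<otimes> (x \<otimes> e) \<otimes> inv e"
    using carr by (simp add: m_assoc)
  also have "\<dots> = f \<otimes> inv e"
    using carr by (simp add: eq m_assoc[symmetric])
  finally have "inv y \<otimes> x \<in> X \<inter> E"
    using x y e f X E by (metis IntI subgroup.m_closed subgroup.m_inv_closed)
  then have "inv y \<otimes> x = \<one>" using triv by blast
  then have "x = y"
    using carr by (metis inv_solve_left' one_closed r_one)
  then show "x \<in> T" using y by simp
next
  assume comp: "\<forall>x\<in>X. \<forall>e\<in>E. x \<otimes> e \<in> T \<longrightarrow> x \<in> T"
  show "T = (T \<inter> X) <#> (T \<inter> E)"
  proof
    show "(T \<inter> X) <#> (T \<inter> E) \<subseteq> T"
      using subgroup.m_closed[OF T] by (auto simp: mem_set_mult_iff)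
    show "T \<subseteq> (T \<inter> X) <#> (T \<inter> E)"
    proof
      fix t assume t: "t \<in> T"
      then have "t \<in> X <#> E"
        using G_eq T subgroup.mem_carrier by metis
      then obtain x e where xe: "x \<in> X" "e \<in> E" "t = x \<otimes> e"
        by (auto simp: mem_set_mult_iff)
      have xT: "x \<in> T" using comp xe t by blast
      have "e = inv x \<otimes> t"
        using xe X E by (metis inv_solve_left subgroup.mem_carrier m_closed)
      then have "e \<in> T"
        using xT t T by (metis subgroup.m_closed subgroup.m_inv_closed)
      then show "t \<in> (T \<inter> X) <#> (T \<inter> E)"
        using xT xe by (auto simp: mem_set_mult_iff)
    qed
  qed
qed

text \<open>
  The set \<open>(T \<inter> K)H \<inter> (T \<inter> K)E\<close> collects the products \<open>n h\<close> for which \<open>h\<close> agrees with an element of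
  \<open>E\<close> up to a left factor in \<open>T \<inter> K\<close>. Unique components along \<open>H\<close> and \<open>E\<close> are what forces such an
  \<open>h\<close> into \<open>T\<close> in one direction, and what recovers the splitting along \<open>H\<close> and \<open>E\<close> in the other.
\<close>

lemma factorised_along_both_iff:
  assumes T: "subgroup T G" and K: "subgroup K G" and H: "subgroup H G" and E: "subgroup E G"
    and G_eq: "carrier G = H <#> E" and triv: "H \<inter> E = {\<one>}"
  shows "T = (T \<inter> K) <#> (T \<inter> E) \<and> T = (T \<inter> H) <#> (T \<inter> E)
     \<longleftrightarrow> T = (((T \<inter> K) <#> H) \<inter> ((T \<inter> K) <#> E)) <#> (T \<inter> E)"
    (is "?KE \<and> ?HE \<longleftrightarrow> T = ?A <#> (T \<inter> E)")
proof
  note HE_iff = factorised_iff_components[OF T H E G_eq triv]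
  note carr = subgroup.mem_carrier[OF T] subgroup.mem_carrier[OF K]
    subgroup.mem_carrier[OF H] subgroup.mem_carrier[OF E]
  {
    assume "?KE \<and> ?HE"
    then have KE: ?KE and HE: ?HE by blast+
    have "?A \<subseteq> T"
    proof
      fix a assume "a \<in> ?A"
      then obtain n h m e where n: "n \<in> T" and h: "h \<in> H" and m: "m \<in> T" and e: "e \<in> E"
        and a: "a = n \<otimes> h" "a = m \<otimes> e"
        by (auto simp: mem_set_mult_iff)
      have "h \<otimes> inv e = inv n \<otimes> (n \<otimes> h) \<otimes> inv e"
        using n h e carr by (simp add: m_assoc[symmetric])
      also have "\<dots> = inv n \<otimes> (m \<otimes> e) \<otimes> inv e" using a by simp
      also have "\<dots> = inv n \<otimes> m"
        using n m e carr by (simp add: m_assoc)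
      finally have "h \<otimes> inv e \<in> T"
        using n m T by (simp add: subgroup.m_closed subgroup.m_inv_closed)
      then have "h \<in> T"
        using HE HE_iff h e subgroup.m_inv_closed[OF E] by blast
      then show "a \<in> T" using a n subgroup.m_closed[OF T] by simp
    qed
    then have "?A <#> (T \<inter> E) \<subseteq> T"
      unfolding subset_iff mem_set_mult_iff[of _ _ ?A] using subgroup.m_closed[OF T] by blast
    moreover have "T \<subseteq> ?A <#> (T \<inter> E)"
    proof
      fix t assume "t \<in> T"
      then have "t \<in> (T \<inter> H) <#> (T \<inter> E)" using HE by blast
      then obtain h e where h: "h \<in> T" "h \<in> H" and e: "e \<in> T \<inter> E" and t: "t = h \<otimes> e"
        unfolding mem_set_mult_iff by blast
      have "h \<in> (T \<inter> K) <#> (T \<inter> E)" using KE h by blast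
      then have "h \<in> (T \<inter> K) <#> E" by (auto simp: mem_set_mult_iff)
      moreover have "h = \<one> \<otimes> h" "\<one> \<in> T \<inter> K"
        using h carr subgroup.one_closed[OF T] subgroup.one_closed[OF K] by auto
      then have "h \<in> (T \<inter> K) <#> H"
        using h unfolding mem_set_mult_iff by blast
      ultimately show "t \<in> ?A <#> (T \<inter> E)"
        unfolding mem_set_mult_iff[of t] using e t by blast
    qed
    ultimately show "T = ?A <#> (T \<inter> E)" by blast
  next
    assume T_eq: "T = ?A <#> (T \<inter> E)"
    have A_T: "?A \<subseteq> T"
    proof
      fix a assume a: "a \<in> ?A"
      then have "a \<in> carrier G" using carr by (auto simp: mem_set_mult_iff)
      then have "a = a \<otimes> \<one>" by simp
      moreover have "\<one> \<in> T \<inter> E"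
        using subgroup.one_closed[OF T] subgroup.one_closed[OF E] by simp
      ultimately have "a \<in> ?A <#> (T \<inter> E)"
        unfolding mem_set_mult_iff[of a _ ?A] using a by blast
      then show "a \<in> T" using T_eq by blast
    qed
    have KE: ?KE
    proof
      show "(T \<inter> K) <#> (T \<inter> E) \<subseteq> T"
        using subgroup.m_closed[OF T] by (auto simp: mem_set_mult_iff)
      show "T \<subseteq> (T \<inter> K) <#> (T \<inter> E)"
      proof
        fix t assume "t \<in> T"
        then have "t \<in> ?A <#> (T \<inter> E)" using T_eq by blast
        then obtain a f where a: "a \<in> ?A" and f: "f \<in> T" "f \<in> E" and t: "t = a \<otimes> f"
          unfolding mem_set_mult_iff[of t] by blast
        obtain m e where m: "m \<in> T" "m \<in> K" and e: "e \<in> E" and a_eq: "a = m \<otimes> e"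
          using a by (auto simp: mem_set_mult_iff)
        have "e = inv m \<otimes> a"
          using m e a_eq carr by (simp add: m_assoc[symmetric])
        moreover have "a \<in> T" using a A_T by blast
        ultimately have "e \<in> T"
          using m T by (simp add: subgroup.m_closed subgroup.m_inv_closed)
        then have "e \<otimes> f \<in> T \<inter> E"
          using e f subgroup.m_closed T E by (metis IntI)
        moreover have "t = m \<otimes> (e \<otimes> f)"
          using t a_eq m e f carr by (simp add: m_assoc)
        ultimately show "t \<in> (T \<inter> K) <#> (T \<inter> E)"
          unfolding mem_set_mult_iff using m by blast
      qed
    qed
    \<comment> \<open>Splitting \<open>h e\<close> along \<open>K\<close> and \<open>E\<close> puts \<open>h\<close> into \<open>(T \<inter> K)E\<close>; it lies in \<open>(T \<inter> K)H\<close> anyway.\<close>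
    have "h \<in> T" if h: "h \<in> H" and e: "e \<in> E" and he: "h \<otimes> e \<in> T" for h e
    proof -
      have "h \<otimes> e \<in> (T \<inter> K) <#> (T \<inter> E)" using he KE by blast
      then obtain m f where m: "m \<in> T" "m \<in> K" and f: "f \<in> E" and eq: "h \<otimes> e = m \<otimes> f"
        by (auto simp: mem_set_mult_iff)
      have "h = (h \<otimes> e) \<otimes> inv e"
        using h e carr by (simp add: m_assoc)
      also have "\<dots> = m \<otimes> (f \<otimes> inv e)"
        unfolding eq using m f e carr by (simp add: m_assoc)
      finally have "h = m \<otimes> (f \<otimes> inv e)" .
      moreover have "f \<otimes> inv e \<in> E"
        using e f E by (simp add: subgroup.m_closed subgroup.m_inv_closed)
      ultimately have "h \<in> (T \<inter> K) <#> E"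
        unfolding mem_set_mult_iff using m by blast
      moreover have "h = \<one> \<otimes> h" "\<one> \<in> T \<inter> K"
        using h carr subgroup.one_closed[OF T] subgroup.one_closed[OF K] by auto
      then have "h \<in> (T \<inter> K) <#> H"
        using h unfolding mem_set_mult_iff by blast
      ultimately show ?thesis using A_T by blast
    qed
    then have ?HE using HE_iff by blast
    with KE show "?KE \<and> ?HE" by blast
  }
qed

end

section \<open>Passing to a homomorphic image\<close>

context group_hom
begin

text \<open>
  A common value of \<open>h\<close> on \<open>X\<close> and on \<open>E\<close>, say \<open>h x = h e\<close>, is the same as a product \<open>x e\<^sup>-\<^sup>1\<close>
  in the kernel, and this value is the identity exactly when \<open>x\<close> is in the kernel. The right side is
  the component condition of \<open>factorised_iff_components\<close> for the kernel.
\<close>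

lemma images_meet_trivially_iff:
  assumes X: "subgroup X G" and E: "subgroup E G"
  shows "h ` X \<inter> h ` E = {\<one>\<^bsub>H\<^esub>}
     \<longleftrightarrow> (\<forall>x\<in>X. \<forall>e\<in>E. x \<otimes> e \<in> kernel G H h \<longrightarrow> x \<in> kernel G H h)"
proof (intro iffI ballI impI)
  note carr = subgroup.mem_carrier[OF X] subgroup.mem_carrier[OF E]
  {
    fix x e
    assume meet: "h ` X \<inter> h ` E = {\<one>\<^bsub>H\<^esub>}" and x: "x \<in> X" and e: "e \<in> E"
      and "x \<otimes> e \<in> kernel G H h"
    then have "h x \<otimes>\<^bsub>H\<^esub> h e = \<one>\<^bsub>H\<^esub>"
      using carr by (simp add: kernel_def)
    then have "h x = h (inv e)"
      using x e carr by (metis H.inv_equality hom_closed hom_inv)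
    then have "h x \<in> h ` X \<inter> h ` E"
      using x e subgroup.m_inv_closed[OF E] by blast
    then show "x \<in> kernel G H h"
      using meet x carr by (simp add: kernel_def)
  next
    assume comp: "\<forall>x\<in>X. \<forall>e\<in>E. x \<otimes> e \<in> kernel G H h \<longrightarrow> x \<in> kernel G H h"
    have "h x = \<one>\<^bsub>H\<^esub>" if "x \<in> X" "e \<in> E" "h x = h e" for x e
    proof -
      have "x \<otimes> inv e \<in> kernel G H h"
        using that carr by (simp add: kernel_def)
      then have "x \<in> kernel G H h"
        using comp that subgroup.m_inv_closed[OF E] by blast
      then show ?thesis by (simp add: kernel_def)
    qed
    moreover have "\<one>\<^bsub>H\<^esub> \<in> h ` X \<inter> h ` E"
      using subgroup.one_closed[OF X] subgroup.one_closed[OF E] hom_one by (metis IntI imageI)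
    ultimately show "h ` X \<inter> h ` E = {\<one>\<^bsub>H\<^esub>}" by blast
  }
qed

text \<open>
  A surjective homomorphism preserves products of subsets, subgroups and normality, but two subgroups
  with trivial intersection can have images that share more than the identity.
\<close>

lemma trifactorised_image_iff:
  assumes tri: "trifactorised_group G K L E" and surj: "h ` carrier G = carrier H"
  shows "trifactorised_group H (h ` K) (h ` L) (h ` E)
     \<longleftrightarrow> h ` K \<inter> h ` E = {\<one>\<^bsub>H\<^esub>} \<and> h ` L \<inter> h ` E = {\<one>\<^bsub>H\<^esub>}"
proof -
  have K: "K \<lhd> G" and sub: "subgroup L G" "subgroup E G"
    and prods: "carrier G = K <#> E" "carrier G = K <#> L" "carrier G = L <#> E"
    using tri by (auto simp: trifactorised_group_def)
  have subs: "K \<subseteq> carrier G" "L \<subseteq> carrier G" "E \<subseteq> carrier G"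
    using K sub normal_imp_subgroup subgroup.subset by blast+
  have image_prod: "carrier H = h ` X <#>\<^bsub>H\<^esub> h ` Y"
    if "carrier G = X <#> Y" "X \<subseteq> carrier G" "Y \<subseteq> carrier G" for X Y
    using set_mult_hom[OF homh that(2,3)] that(1) surj by simp
  have "h ` K \<lhd> H"
    using normal.surj_hom_normal_subgroup[OF K] group_hom_axioms surj by blast
  then show ?thesis
    using subgroup_img_is_subgroup sub H.is_group
      image_prod[OF prods(1)] image_prod[OF prods(2)] image_prod[OF prods(3)] subs
    by (simp add: trifactorised_group_def)
qed

end

section \<open>The quotient map\<close>

text \<open>
  A coset \<open>T x t\<close> with \<open>t \<in> T\<close> equals \<open>T x\<close>, so the factor \<open>T\<close> in \<open>X T\<close> contributes no new cosets:
  \<open>X T / T\<close> is the image of \<open>X\<close> under the canonical projection.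
\<close>

lemma (in group) quotient_subgroup_eq_image:
  assumes T: "T \<lhd> G" and X: "subgroup X G"
  shows "quotient_subgroup G X T = (\<lambda>x. T #> x) ` X"
proof -
  interpret T: normal T G by (rule T)
  have absorb: "T #> (x \<otimes> t) = T #> x" if "x \<in> X" "t \<in> T" for x t
  proof -
    have x: "x \<in> carrier G" using X that subgroup.mem_carrier by metis
    have "T #> (x \<otimes> t) = (T #> x) <#> (T #> t)"
      using x that T.rcos_sum by simp
    also have "\<dots> = (T #> x) <#> (T #> \<one>)"
      using that T.rcos_const T.subset by simp
    also have "\<dots> = T #> x" using x T.rcos_sum by simp
    finally show ?thesis .
  qed
  have cosets: "quotient_subgroup G X T = (\<lambda>y. T #> y) ` (X <#> T)"
    by (auto simp: quotient_subgroup_def FactGroup_def RCOSETS_def r_coset_def)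
  have "X \<subseteq> X <#> T"
  proof
    fix x assume "x \<in> X"
    then show "x \<in> X <#> T"
      using X subgroup.mem_carrier T.one_closed r_one unfolding mem_set_mult_iff by metis
  qed
  moreover have "(\<lambda>y. T #> y) ` (X <#> T) \<subseteq> (\<lambda>y. T #> y) ` X"
    using absorb by (auto simp: mem_set_mult_iff)
  ultimately show ?thesis unfolding cosets by blast
qed

lemma (in normal) kernel_r_coset: "kernel G (G Mod H) (\<lambda>x. H #> x) = H"
proof -
  have "H #> x = H \<longleftrightarrow> x \<in> H" if "x \<in> carrier G" for x
    using that coset_join1 coset_join2 subgroup_axioms by blast
  then show ?thesis using subset by (auto simp: kernel_def)
qed

section \<open>Trifactorised quotients\<close>

theorem theorem6p3:
  fixes G (structure) and K H E T :: "'a set"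
  assumes "trifactorised_group G K H E"
    and "T \<lhd> G"
  shows "(trifactorised_group (G Mod T)
            (quotient_subgroup G K T) (quotient_subgroup G H T) (quotient_subgroup G E T)
          \<longleftrightarrow> T = (T \<inter> K) <#> (T \<inter> E) \<and> T = (T \<inter> H) <#> (T \<inter> E))
       \<and> (T = (T \<inter> K) <#> (T \<inter> E) \<and> T = (T \<inter> H) <#> (T \<inter> E)
          \<longleftrightarrow> T = (((T \<inter> K) <#> H) \<inter> ((T \<inter> K) <#> E)) <#> (T \<inter> E))"
proof -
  interpret T: normal T G by (rule assms(2))
  have sub: "subgroup K G" "subgroup H G" "subgroup E G"
    and compl: "carrier G = K <#> E" "K \<inter> E = {\<one>}" "carrier G = H <#> E" "H \<inter> E = {\<one>}"
    using assms(1) normal_imp_subgroup by (auto simp: trifactorised_group_def)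
  define \<pi> where "\<pi> = (\<lambda>x. T #> x)"
  interpret \<pi>: group_hom G "G Mod T" \<pi>
    unfolding \<pi>_def
    by (intro group_hom.intro group_hom_axioms.intro T.is_group T.factorgroup_is_group
        T.r_coset_hom_Mod)
  have ker: "kernel G (G Mod T) \<pi> = T"
    unfolding \<pi>_def by (rule T.kernel_r_coset)
  have surj: "\<pi> ` carrier G = carrier (G Mod T)"
    by (auto simp: \<pi>_def FactGroup_def RCOSETS_def)
  have quot: "quotient_subgroup G X T = \<pi> ` X" if "subgroup X G" for X
    using T.quotient_subgroup_eq_image[OF assms(2) that] by (simp add: \<pi>_def)
  have meet: "\<pi> ` X \<inter> \<pi> ` E = {\<one>\<^bsub>G Mod T\<^esub>} \<longleftrightarrow> T = (T \<inter> X) <#> (T \<inter> E)"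
    if "subgroup X G" "carrier G = X <#> E" "X \<inter> E = {\<one>}" for X
    using \<pi>.images_meet_trivially_iff[OF that(1) sub(3)]
      T.factorised_iff_components[OF T.subgroup_axioms that(1) sub(3) that(2,3)]
    unfolding ker by blast
  have "trifactorised_group (G Mod T)
            (quotient_subgroup G K T) (quotient_subgroup G H T) (quotient_subgroup G E T)
          \<longleftrightarrow> T = (T \<inter> K) <#> (T \<inter> E) \<and> T = (T \<inter> H) <#> (T \<inter> E)"
    unfolding quot[OF sub(1)] quot[OF sub(2)] quot[OF sub(3)]
      \<pi>.trifactorised_image_iff[OF assms(1) surj]
      meet[OF sub(1) compl(1,2)] meet[OF sub(2) compl(3,4)] ..
  then show ?thesis
    using T.factorised_along_both_iff[OF T.subgroup_axioms sub compl(3,4)] by blast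
qed

end
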